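(* Let $k\in\mathbb{N}$, let $f_1,\dots,f_k:\mathbb{R}\to\mathbb{R}$ be (real) analytic functions such that $\{1,f_1,\dots,f_k\}$ is linearly independent over $\mathbb{R}$, and let $I\subset\mathbb{R}$ be a compact interval. Then there exist $C,\delta>0$ such that for every non-zero $\lambda=(\lambda_1,\dots,\lambda_k)\in\mathbb{R}^k$, $$\left|\int_I e\big(\lambda_1f_1(x)+\cdots+\lambda_kf_k(x)\big)\,dx\right|\le C\|\lambda\|^{-\delta}.$$
   Context: $e(t)=e^{2\pi i t}$ for $t\in\mathbb{R}$, and $\|\cdot\|$ is the Euclidean norm on $\mathbb{R}^k$. Linear independence of $\{1,f_1,\dots,f_k\}$ is meant for the family (no nontrivial real linear combination of $1,f_1,\dots,f_k$ vanishes identically). *)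

theory Defs
  imports "HOL-Analysis.Analysis"
begin

text \<open>Real analyticity on the whole line: a convergent power series expansion near every point.
  (The library's \<open>analytic_on\<close> concerns complex functions only.)\<close>

definition real_analytic :: "(real \<Rightarrow> real) \<Rightarrow> bool" where
  "real_analytic f \<longleftrightarrow>
     (\<forall>x0. \<exists>r>0. \<exists>a :: nat \<Rightarrow> real. \<forall>x. \<bar>x - x0\<bar> < r \<longrightarrow> (\<lambda>n. a n * (x - x0) ^ n) sums f x)"

text \<open>Linear independence of \<open>1, f\<^sub>1, \<dots>, f\<^sub>k\<close> as a family rather than as a set, so a repeated
  function counts as a dependency.\<close>

definition lin_indep_with_one :: "('k::finite \<Rightarrow> real \<Rightarrow> real) \<Rightarrow> bool" where
  "lin_indep_with_one f \<longleftrightarrow>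
     (\<forall>(c0::real) (c :: 'k \<Rightarrow> real).
        (\<forall>x. c0 * 1 + (\<Sum>j\<in>UNIV. c j * f j x) = 0) \<longrightarrow> c0 = 0 \<and> (\<forall>j. c j = 0))"

definition e :: "real \<Rightarrow> complex" where
  "e t = exp (2 * complex_of_real pi * \<i> * complex_of_real t)"

end

theory Submission
  imports Defs
begin

text \<open>
  For \<open>\<theta>\<close> in the unit sphere the function \<open>\<Sum>j. \<theta> $ j * f j\<close> is a nonconstant analytic function, so at
  each point one of its derivatives of positive order is nonzero. By compactness of the sphere times
  the interval, the interval splits into boundedly many pieces such that on each piece, and for each
  \<open>\<theta>\<close>, a derivative of bounded order is bounded away from zero. A van der Corput estimate on each
  piece, with constants uniform in \<open>\<theta>\<close>, gives the decay.
\<close>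

section \<open>Real analytic functions\<close>

text \<open>Termwise differentiation, moved from centre 0 to \<open>x0\<close>. The conclusions
  speak of \<open>deriv f\<close> and keep the radius \<open>r\<close>, so that the lemma can be
  iterated.\<close>

lemma power_series_deriv:
  fixes f :: "real \<Rightarrow> real"
  assumes f: "\<And>x. \<bar>x - x0\<bar> < r \<Longrightarrow> (\<lambda>n. a n * (x - x0) ^ n) sums f x"
    and x: "\<bar>x - x0\<bar> < r"
  shows "(f has_real_derivative deriv f x) (at x)"
    and "(\<lambda>n. diffs a n * (x - x0) ^ n) sums deriv f x"
proof -
  have sm: "summable (\<lambda>n. a n * y ^ n)" if "norm y < r" for y
    using f[of "x0 + y"] that by (auto simp: sums_iff)
  \<comment> \<open>Termwise differentiation requires convergence at some point strictly farther
    from the centre than \<open>x\<close>.\<close>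
  obtain K where K: "\<bar>x - x0\<bar> < K" "K < r"
    using x dense by blast
  have "DERIV (\<lambda>x. \<Sum>n. a n * x ^ n) (x - x0) :> (\<Sum>n. diffs a n * (x - x0) ^ n)"
    by (rule termdiffs_strong[of a K]) (use K in \<open>auto intro: sm\<close>)
  then have "((\<lambda>x. \<Sum>n. a n * (x - x0) ^ n) has_real_derivative (\<Sum>n. diffs a n * (x - x0) ^ n)) (at x)"
    using DERIV_shift[of "\<lambda>x. \<Sum>n. a n * x ^ n" _ x "- x0"] by simp
  then have D: "(f has_real_derivative (\<Sum>n. diffs a n * (x - x0) ^ n)) (at x)"
  proof (rule has_field_derivative_transform_within_open[where S = "ball x0 r"])
    show "(\<Sum>n. a n * (y - x0) ^ n) = f y" if "y \<in> ball x0 r" for y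
      using f[of y] that by (auto simp: sums_iff dist_real_def abs_minus_commute)
  qed (use x in \<open>auto simp: dist_real_def abs_minus_commute\<close>)
  have "summable (\<lambda>n. diffs a n * (x - x0) ^ n)"
    by (rule termdiff_converges[of _ r]) (use x sm in auto)
  then show "(\<lambda>n. diffs a n * (x - x0) ^ n) sums deriv f x"
    using DERIV_imp_deriv[OF D] by (simp add: sums_iff)
  show "(f has_real_derivative deriv f x) (at x)"
    using D DERIV_imp_deriv[OF D] by simp
qed

lemma real_analytic_DERIV:
  assumes "real_analytic f"
  shows "(f has_real_derivative deriv f x) (at x)"
proof -
  obtain r a where "r > 0" "\<And>y. \<bar>y - x\<bar> < r \<Longrightarrow> (\<lambda>n. a n * (y - x) ^ n) sums f y"
    using assms unfolding real_analytic_def by metis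
  then show ?thesis
    by (intro power_series_deriv(1)[of x r a]) auto
qed

lemma real_analytic_deriv:
  assumes "real_analytic f"
  shows "real_analytic (deriv f)"
  unfolding real_analytic_def
proof
  fix x0
  obtain r a where "r > 0" "\<And>y. \<bar>y - x0\<bar> < r \<Longrightarrow> (\<lambda>n. a n * (y - x0) ^ n) sums f y"
    using assms unfolding real_analytic_def by metis
  then show "\<exists>r>0. \<exists>a. \<forall>x. \<bar>x - x0\<bar> < r \<longrightarrow> (\<lambda>n. a n * (x - x0) ^ n) sums deriv f x"
    using power_series_deriv(2)[of x0 r a f] by blast
qed

lemma real_analytic_higher_deriv:
  "real_analytic f \<Longrightarrow> real_analytic ((deriv ^^ n) f)"
  by (induction n) (auto intro: real_analytic_deriv)

lemma real_analytic_const: "real_analytic (\<lambda>x. c)"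
proof -
  have "(\<lambda>n. (if n = 0 then c else 0) * (x - x0) ^ n) sums c" for x x0 :: real
    using sums_finite[of "{0}" "\<lambda>n. (if n = 0 then c else 0) * (x - x0) ^ n"] by simp
  then show ?thesis
    unfolding real_analytic_def by (metis zero_less_one)
qed

lemma real_analytic_cmult:
  assumes "real_analytic f"
  shows "real_analytic (\<lambda>x. c * f x)"
  unfolding real_analytic_def
proof
  fix x0
  obtain r a where r: "r > 0" "\<And>y. \<bar>y - x0\<bar> < r \<Longrightarrow> (\<lambda>n. a n * (y - x0) ^ n) sums f y"
    using assms unfolding real_analytic_def by metis
  have "(\<lambda>n. (c * a n) * (x - x0) ^ n) sums (c * f x)" if "\<bar>x - x0\<bar> < r" for x
    using sums_mult[OF r(2)[OF that], of c] by (simp add: mult.assoc)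
  then show "\<exists>r>0. \<exists>a. \<forall>x. \<bar>x - x0\<bar> < r \<longrightarrow> (\<lambda>n. a n * (x - x0) ^ n) sums (c * f x)"
    using r(1) by (intro exI[of _ r] conjI exI[of _ "\<lambda>n. c * a n"]) auto
qed

lemma real_analytic_add:
  assumes "real_analytic f" "real_analytic g"
  shows "real_analytic (\<lambda>x. f x + g x)"
  unfolding real_analytic_def
proof
  fix x0
  obtain r a where r: "r > 0" "\<And>y. \<bar>y - x0\<bar> < r \<Longrightarrow> (\<lambda>n. a n * (y - x0) ^ n) sums f y"
    using assms(1) unfolding real_analytic_def by metis
  obtain s b where s: "s > 0" "\<And>y. \<bar>y - x0\<bar> < s \<Longrightarrow> (\<lambda>n. b n * (y - x0) ^ n) sums g y"
    using assms(2) unfolding real_analytic_def by metis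
  have "(\<lambda>n. (a n + b n) * (x - x0) ^ n) sums (f x + g x)" if "\<bar>x - x0\<bar> < min r s" for x
    using sums_add[OF r(2) s(2), of x x] that by (simp add: distrib_right)
  moreover have "min r s > 0"
    using r s by simp
  ultimately show "\<exists>r>0. \<exists>a. \<forall>x. \<bar>x - x0\<bar> < r \<longrightarrow> (\<lambda>n. a n * (x - x0) ^ n) sums (f x + g x)"
    by (intro exI[of _ "min r s"] conjI exI[of _ "\<lambda>n. a n + b n"]) auto
qed

lemma real_analytic_sum:
  assumes "\<And>j. j \<in> A \<Longrightarrow> real_analytic (f j)"
  shows "real_analytic (\<lambda>x. \<Sum>j\<in>A. f j x)"
  using assms
  by (induction A rule: infinite_finite_induct)
     (auto intro: real_analytic_const real_analytic_add)

text \<open>At \<open>m = 0\<close> the right-hand side is \<open>fact n * a n\<close>, which ties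
  the Taylor coefficients to the derivatives at the centre. General \<open>m\<close> shows that
  every differentiated series only involves coefficients of index at least \<open>n\<close>.\<close>

lemma funpow_diffs:
  fixes a :: "nat \<Rightarrow> real"
  shows "(diffs ^^ n) a m = fact (n + m) / fact m * a (n + m)"
proof (induction n arbitrary: m)
  case (Suc n)
  have "(diffs ^^ Suc n) a m = real (Suc m) * (diffs ^^ n) a (Suc m)"
    by (simp add: diffs_def)
  also have "\<dots> = fact (Suc n + m) / fact m * a (Suc n + m)"
    unfolding Suc by (simp add: divide_simps del: of_nat_Suc)
  finally show ?case .
qed simp

text \<open>The radius does not shrink with \<open>n\<close>, so one neighbourhood of
  \<open>x0\<close> serves the derivatives of all orders at once.\<close>

lemma power_series_higher_deriv:
  fixes f :: "real \<Rightarrow> real"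
  assumes "\<And>x. \<bar>x - x0\<bar> < r \<Longrightarrow> (\<lambda>n. a n * (x - x0) ^ n) sums f x" "\<bar>x - x0\<bar> < r"
  shows "(\<lambda>m. (diffs ^^ n) a m * (x - x0) ^ m) sums (deriv ^^ n) f x"
  using assms(2)
proof (induction n arbitrary: x)
  case 0
  then show ?case using assms(1) by simp
next
  case (Suc n)
  show ?case
    using power_series_deriv(2)[of x0 r "(diffs ^^ n) a" "(deriv ^^ n) f" x] Suc by simp
qed

text \<open>Identity principle: the points where all derivatives of positive order vanish form a
  closed and open set, hence the whole line as soon as \<open>x0\<close> is one of them.\<close>

lemma real_analytic_constant:
  assumes f: "real_analytic f" and z: "\<And>n. (deriv ^^ Suc n) f x0 = 0"
  shows "f x = f y"
proof -
  define Z where "Z = {x. \<forall>n. (deriv ^^ Suc n) f x = 0}"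
  have cont: "continuous_on UNIV ((deriv ^^ n) f)" for n
    using real_analytic_DERIV[OF real_analytic_higher_deriv[OF f]]
    by (intro DERIV_continuous_on) (auto intro: has_field_derivative_at_within)
  have "closed Z"
    unfolding Z_def by (intro closed_Collect_all closed_Collect_eq cont continuous_on_const)
  moreover have "open Z"
    unfolding open_dist
  proof
    fix x assume "x \<in> Z"
    obtain r a where r: "r > 0" "\<And>y. \<bar>y - x\<bar> < r \<Longrightarrow> (\<lambda>n. a n * (y - x) ^ n) sums f y"
      using f unfolding real_analytic_def by metis
    \<comment> \<open>At its centre the differentiated series reduces to its constant term, a
      nonzero multiple of \<open>a (Suc n)\<close>.\<close>
    have a: "a (Suc n) = 0" for n
    proof -
      have "(\<lambda>m. (diffs ^^ Suc n) a m * 0 ^ m) sums (deriv ^^ Suc n) f x"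
        using power_series_higher_deriv[of x r a f x "Suc n"] r by simp
      then have "(diffs ^^ Suc n) a 0 = (deriv ^^ Suc n) f x"
        using powser_sums_zero sums_unique2 by blast
      then show ?thesis
        using \<open>x \<in> Z\<close> unfolding funpow_diffs Z_def by simp
    qed
    have "y \<in> Z" if "dist y x < r" for y
    proof -
      have "(\<lambda>m. (diffs ^^ Suc n) a m * (y - x) ^ m) sums (deriv ^^ Suc n) f y" for n
        using power_series_higher_deriv[of x r a f y "Suc n"] r that by (simp add: dist_real_def)
      moreover have "(diffs ^^ Suc n) a m = 0" for n m
        unfolding funpow_diffs using a by simp
      ultimately have "(\<lambda>m. 0) sums (deriv ^^ Suc n) f y" for n
        by (simp del: funpow.simps)
      then have "(deriv ^^ Suc n) f y = 0" for n
        using sums_unique2 sums_zero by blast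
      then show ?thesis
        unfolding Z_def by blast
    qed
    with r show "\<exists>d>0. \<forall>y. dist y x < d \<longrightarrow> y \<in> Z"
      by blast
  qed
  moreover have "x0 \<in> Z"
    using z by (simp add: Z_def)
  ultimately have "Z = UNIV"
    using clopen by blast
  then have "(deriv ^^ Suc 0) f x = 0" for x
    unfolding Z_def by blast
  then have "\<forall>x. DERIV f x :> 0"
    using real_analytic_DERIV[OF f] by simp
  then show ?thesis
    using DERIV_isconst_all by blast
qed

section \<open>Van der Corput estimates\<close>

lemma norm_e [simp]: "norm (e t) = 1"
proof -
  have "e t = exp (\<i> * complex_of_real (2 * pi * t))"
    by (simp add: e_def mult_ac)
  then show ?thesis
    by (simp only: norm_exp_i_times)
qed

text \<open>The complex derivative of the exponential is restricted to the real axis and composed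
  with \<open>g\<close>. The conclusion is relative to \<open>S\<close>, as the fundamental theorem
  of calculus on an interval wants it.\<close>

lemma has_vector_derivative_e:
  assumes "(g has_real_derivative g') (at x)"
  shows "((\<lambda>x. e (g x)) has_vector_derivative (2 * pi * \<i> * g' * e (g x))) (at x within S)"
proof -
  have "(e has_vector_derivative (2 * pi * \<i> * e t)) (at t)" for t
  proof -
    have "((\<lambda>z. exp (2 * complex_of_real pi * \<i> * z)) has_field_derivative (2 * pi * \<i> * e t))
        (at (complex_of_real t))"
      unfolding e_def by (auto intro!: derivative_eq_intros)
    then show ?thesis
      using has_vector_derivative_real_field unfolding e_def by blast
  qed
  then have "((e \<circ> g) has_vector_derivative (g' *\<^sub>R (2 * pi * \<i> * e (g x)))) (at x)"
    using assms has_real_derivative_iff_has_vector_derivative vector_diff_chain_at by blast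
  moreover have "g' *\<^sub>R (2 * pi * \<i> * e (g x)) = 2 * pi * \<i> * g' * e (g x)"
    by (simp add: scaleR_conv_of_real)
  ultimately show ?thesis
    unfolding o_def by (metis has_vector_derivative_at_within)
qed

lemma continuous_on_e_comp:
  "continuous_on S g \<Longrightarrow> continuous_on S (\<lambda>x. e (g x))"
  unfolding e_def by (intro continuous_intros)

lemma norm_integral_e_le:
  assumes "continuous_on {p..q} g" "p \<le> q"
  shows "norm (integral {p..q} (\<lambda>x. e (g x))) \<le> q - p"
  using integral_bound[OF assms(2) continuous_on_e_comp[OF assms(1)], of 1] by simp

text \<open>First derivative test: integrate by parts against \<open>e (R * g) / (2 \<pi> i R g')\<close>.\<close>

lemma van_der_Corput_1:
  fixes h :: "nat \<Rightarrow> real \<Rightarrow> real"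
  assumes der: "\<And>n x. (h n has_real_derivative h (Suc n) x) (at x)"
    and c: "0 < c" "c \<le> 1" and pq: "p \<le> q" "q - p \<le> L" and R: "R > 0"
    and low: "\<And>x. x \<in> {p..q} \<Longrightarrow> c \<le> \<bar>h 1 x\<bar>"
    and up: "\<And>x. x \<in> {p..q} \<Longrightarrow> \<bar>h 2 x\<bar> \<le> M"
  shows "norm (integral {p..q} (\<lambda>x. e (R * h 0 x))) \<le> (M * L + 2) * inverse (c^2) * inverse R"
proof -
  have cont: "continuous_on S (h n)" for S n
    using der by (intro DERIV_continuous_on) (auto intro: has_field_derivative_at_within)
  define w where "w = 2 * complex_of_real pi * \<i> * R"
  have w0: "w \<noteq> 0" and nw: "norm w = 2 * pi * R"
    using R by (auto simp: w_def norm_mult)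
  have nz: "h 1 x \<noteq> 0" if "x \<in> {p..q}" for x
    using low[OF that] c by auto
  \<comment> \<open>\<open>F\<close> supplies the boundary terms. \<open>G\<close> is the correction
    from differentiating \<open>inverse (h 1 x)\<close>: the derivative of \<open>F\<close> is the
    integrand minus \<open>G\<close>.\<close>
  define F where "F = (\<lambda>x. e (R * h 0 x) * complex_of_real (inverse (h 1 x)) / w)"
  define G where "G = (\<lambda>x. e (R * h 0 x) * complex_of_real (h 2 x * inverse ((h 1 x)^2)) / w)"
  have "(F has_vector_derivative (e (R * h 0 x) - G x)) (at x within {p..q})" if x: "x \<in> {p..q}" for x
  proof -
    have 1: "((\<lambda>x. R * h 0 x) has_real_derivative R * h 1 x) (at x)"
      using DERIV_cmult[OF der[of 0 x]] by simp
    have "((\<lambda>x. inverse (h 1 x)) has_real_derivative - (h 2 x * inverse ((h 1 x)^2))) (at x within {p..q})"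
      using DERIV_inverse_fun[OF has_field_derivative_at_within[OF der[of 1 x]] nz[OF x]]
      by (simp add: numeral_2_eq_2)
    then have 2: "((\<lambda>x. complex_of_real (inverse (h 1 x))) has_vector_derivative
        complex_of_real (- (h 2 x * inverse ((h 1 x)^2)))) (at x within {p..q})"
      by (rule has_vector_derivative_of_real)
    have "(F has_vector_derivative
       (e (R * h 0 x) * complex_of_real (- (h 2 x * inverse ((h 1 x)^2))) +
        2 * pi * \<i> * (R * h 1 x) * e (R * h 0 x) * complex_of_real (inverse (h 1 x))) / w) (at x within {p..q})"
      unfolding F_def
      by (rule has_vector_derivative_divide[OF has_vector_derivative_mult[OF has_vector_derivative_e[OF 1] 2]])
    moreover have "(e (R * h 0 x) * complex_of_real (- (h 2 x * inverse ((h 1 x)^2))) +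
        2 * pi * \<i> * (R * h 1 x) * e (R * h 0 x) * complex_of_real (inverse (h 1 x))) / w
        = e (R * h 0 x) - G x"
      using w0 nz[OF x] unfolding G_def w_def by (simp add: field_simps)
    ultimately show ?thesis by simp
  qed
  then have I: "((\<lambda>x. e (R * h 0 x) - G x) has_integral (F q - F p)) {p..q}"
    by (rule fundamental_theorem_of_calculus[OF pq(1)])
  have contG: "continuous_on {p..q} G"
    unfolding G_def using nz w0
    by (intro continuous_intros continuous_on_e_comp cont) auto
  have "((\<lambda>x. e (R * h 0 x)) has_integral (F q - F p + integral {p..q} G)) {p..q}"
    using has_integral_add[OF I integrable_integral[OF integrable_continuous_real[OF contG]]] by simp
  then have eq: "integral {p..q} (\<lambda>x. e (R * h 0 x)) = F q - F p + integral {p..q} G"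
    by (rule integral_unique)
  \<comment> \<open>Since \<open>c \<le> 1\<close>, the boundary terms can be given the same factor
    \<open>inverse (c^2)\<close> as the remainder integral.\<close>
  have c2: "inverse c \<le> inverse (c^2)"
    using c by (simp add: power2_eq_square field_simps)
  have pi1: "inverse (2 * pi * R) \<le> inverse R"
    using R pi_gt3 by (intro le_imp_inverse_le) auto
  have nF: "norm (F x) \<le> inverse (c^2) * inverse R" if x: "x \<in> {p..q}" for x
  proof -
    have "norm (F x) = inverse \<bar>h 1 x\<bar> * inverse (2 * pi * R)"
      by (simp add: F_def norm_mult norm_divide norm_inverse nw divide_simps)
    also have "\<dots> \<le> inverse c * inverse R"
      by (intro mult_mono le_imp_inverse_le pi1 low[OF x]) (use c R in auto)
    also have "\<dots> \<le> inverse (c^2) * inverse R"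
      using c2 R by (intro mult_right_mono) auto
    finally show ?thesis .
  qed
  have M: "0 \<le> M"
    using up[of p] pq by auto
  have nG: "norm (G x) \<le> M * (inverse (c^2) * inverse R)" if x: "x \<in> {p..q}" for x
  proof -
    have "c^2 \<le> (h 1 x)^2"
      using low[OF x] c by (metis abs_of_pos abs_le_square_iff)
    then have i: "inverse ((h 1 x)^2) \<le> inverse (c^2)"
      using c by (intro le_imp_inverse_le) auto
    have "norm (G x) = \<bar>h 2 x\<bar> * (inverse ((h 1 x)^2) * inverse (2 * pi * R))"
      by (simp add: G_def norm_mult norm_divide norm_inverse norm_power nw divide_simps)
    also have "\<dots> \<le> M * (inverse (c^2) * inverse R)"
      using up[OF x] i pi1 R M by (intro mult_mono) auto
    finally show ?thesis .
  qed
  have "norm (integral {p..q} G) \<le> M * (inverse (c^2) * inverse R) * (q - p)"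
    using integral_bound[OF pq(1) contG] nG by blast
  also have "\<dots> \<le> M * (inverse (c^2) * inverse R) * L"
    using pq M R c by (intro mult_left_mono) auto
  finally have nI: "norm (integral {p..q} G) \<le> M * (inverse (c^2) * inverse R) * L" .
  have "norm (integral {p..q} (\<lambda>x. e (R * h 0 x))) \<le> norm (F q) + norm (F p) + norm (integral {p..q} G)"
    unfolding eq by (intro norm_triangle_le add_right_mono norm_triangle_ineq4)
  also have "\<dots> \<le> inverse (c^2) * inverse R + inverse (c^2) * inverse R + M * (inverse (c^2) * inverse R) * L"
    using nF nI pq by (intro add_mono) auto
  finally show ?thesis
    by (simp add: algebra_simps)
qed

text \<open>Around a minimum \<open>x0\<close> of \<open>\<bar>u\<bar>\<close>, one has \<open>2 * \<eta> \<le> \<bar>u x - u x0\<bar> \<le> 2 * \<bar>u x\<bar>\<close> as soon as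
  \<open>\<bar>x - x0\<bar> \<ge> 2 * \<eta> / c\<close>.\<close>

lemma sublevel_interval:
  fixes u :: "real \<Rightarrow> real"
  assumes der: "\<And>x. (u has_real_derivative u' x) (at x)"
    and c: "0 < c" and pq: "p \<le> q" and \<eta>: "\<eta> > 0"
    and low: "\<And>x. x \<in> {p..q} \<Longrightarrow> c \<le> \<bar>u' x\<bar>"
  obtains s t where "p \<le> s" "s \<le> t" "t \<le> q" "t - s \<le> 4 * \<eta> / c"
    "\<And>x. p < s \<Longrightarrow> x \<in> {p..s} \<Longrightarrow> \<eta> \<le> \<bar>u x\<bar>" "\<And>x. t < q \<Longrightarrow> x \<in> {t..q} \<Longrightarrow> \<eta> \<le> \<bar>u x\<bar>"
proof -
  \<comment> \<open>Mean value theorem; only the size of \<open>u'\<close> at the intermediate point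
    matters, not its sign.\<close>
  have expand: "c * (y - x) \<le> \<bar>u y - u x\<bar>" if "p \<le> x" "x \<le> y" "y \<le> q" for x y
  proof (cases "x = y")
    case False
    then have "x < y"
      using that by simp
    then obtain z where z: "x < z" "z < y" "u y - u x = (y - x) * u' z"
      using MVT2[of x y u u', OF _ der] by blast
    have "c * (y - x) \<le> \<bar>u' z\<bar> * (y - x)"
      using low[of z] z that by (intro mult_right_mono) auto
    also have "\<dots> = \<bar>u y - u x\<bar>"
      using z that by (simp add: abs_mult)
    finally show ?thesis .
  qed auto
  have "continuous_on {p..q} (\<lambda>x. \<bar>u x\<bar>)"
    using der by (intro continuous_intros DERIV_continuous_on) (auto intro: has_field_derivative_at_within)
  then obtain x0 where x0: "x0 \<in> {p..q}" "\<And>x. x \<in> {p..q} \<Longrightarrow> \<bar>u x0\<bar> \<le> \<bar>u x\<bar>"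
    using continuous_attains_inf[of "{p..q}" "\<lambda>x. \<bar>u x\<bar>"] pq by auto
  have far: "\<eta> \<le> \<bar>u x\<bar>" if x: "x \<in> {p..q}" and d: "2 * \<eta> / c \<le> \<bar>x - x0\<bar>" for x
  proof -
    have "2 * \<eta> \<le> c * \<bar>x - x0\<bar>"
      using d c by (simp add: field_simps)
    also have "\<dots> \<le> \<bar>u x - u x0\<bar>"
      using expand[of x x0] expand[of x0 x] x x0(1) by (cases "x \<le> x0") (auto simp: abs_minus_commute)
    finally show ?thesis
      using x0(2)[OF x] by linarith
  qed
  \<comment> \<open>The window around \<open>x0\<close> is clipped to \<open>{p..q}\<close>. Where
    clipping takes effect, the outer piece is a single point at which \<open>\<bar>u\<bar>\<close>
    may be below \<open>\<eta>\<close>; hence the guards \<open>p < s\<close> and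
    \<open>t < q\<close> in the conclusion.\<close>
  define s where "s = max p (x0 - 2 * \<eta> / c)"
  define t where "t = min q (x0 + 2 * \<eta> / c)"
  have pos: "2 * \<eta> / c > 0"
    using c \<eta> by simp
  show thesis
  proof (rule that[of s t])
    show "p \<le> s" "s \<le> t" "t \<le> q"
      using x0(1) pos by (auto simp: s_def t_def)
    have "t - s \<le> 2 * (2 * \<eta> / c)"
      unfolding s_def t_def by linarith
    then show "t - s \<le> 4 * \<eta> / c"
      by simp
    show "\<eta> \<le> \<bar>u x\<bar>" if "p < s" "x \<in> {p..s}" for x
    proof (rule far)
      have "s = x0 - 2 * \<eta> / c" using that(1) unfolding s_def by linarith
      then show "2 * \<eta> / c \<le> \<bar>x - x0\<bar>" "x \<in> {p..q}"
        using that x0(1) pos by auto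
    qed
    show "\<eta> \<le> \<bar>u x\<bar>" if "t < q" "x \<in> {t..q}" for x
    proof (rule far)
      have "t = x0 + 2 * \<eta> / c" using that(1) unfolding t_def by linarith
      then show "2 * \<eta> / c \<le> \<bar>x - x0\<bar>" "x \<in> {p..q}"
        using that x0(1) pos by auto
    qed
  qed
qed

text \<open>The constants satisfy \<open>B\<^bsub>k+1\<^esub> = 4 + 2 * B\<^bsub>k\<^esub>\<close>, and the threshold \<open>\<eta> = R powr (- \<delta> / 3)\<close> balances
  \<open>\<eta>\<close> against \<open>\<eta> powr (- 2) * R powr (- \<delta>)\<close>. The exponent \<open>1 / 3 ^ k\<close> is not optimal.\<close>

lemma van_der_Corput:
  fixes h :: "nat \<Rightarrow> real \<Rightarrow> real"
  assumes der: "\<And>n x. (h n has_real_derivative h (Suc n) x) (at x)"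
    and "0 < c" "c \<le> 1" "p \<le> q" "q - p \<le> L" and R: "R \<ge> 1"
    and "\<And>x. x \<in> {p..q} \<Longrightarrow> c \<le> \<bar>h (Suc k) x\<bar>"
    and "\<And>x. x \<in> {p..q} \<Longrightarrow> \<bar>h 2 x\<bar> \<le> M"
  shows "norm (integral {p..q} (\<lambda>x. e (R * h 0 x)))
    \<le> ((M * L + 6) * 2 ^ k - 4) * inverse (c^2) * R powr (- (1 / 3 ^ k))"
  using assms(2-5,7,8)
proof (induction k arbitrary: c p q)
  \<comment> \<open>Here \<open>(M * L + 6) * 2 ^ 0 - 4 = M * L + 2\<close>, the constant of the
    first derivative test.\<close>
  case 0
  then show ?case
    using van_der_Corput_1[of h c p q L R M] der R by (simp add: powr_minus add.commute)
next
  case (Suc k)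
  define \<delta> :: real where "\<delta> = 1 / 3 ^ k"
  define \<eta> where "\<eta> = R powr (- (\<delta> / 3))"
  define B where "B = (M * L + 6) * 2 ^ k - 4"
  have \<delta>: "\<delta> > 0" by (simp add: \<delta>_def)
  have \<eta>: "0 < \<eta>" "\<eta> \<le> 1"
    using R \<delta> powr_mono[of "- (\<delta> / 3)" 0 R] by (auto simp: \<eta>_def)
  have \<eta>2: "inverse (\<eta>^2) * R powr (- \<delta>) = \<eta>"
  proof -
    have "inverse (\<eta>^2) = R powr (2 * \<delta> / 3)"
      using R by (simp add: \<eta>_def powr_minus power2_eq_square flip: powr_add)
    then show ?thesis
      using R by (simp add: \<eta>_def flip: powr_add)
  qed
  have "0 \<le> M" "0 \<le> L"
    using Suc.prems(6)[of p] Suc.prems(3,4) by auto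
  then have "6 * 1 \<le> (M * L + 6) * 2 ^ k"
    by (intro mult_mono) auto
  then have B: "0 \<le> B" by (simp add: B_def)
  have cont: "continuous_on S (\<lambda>x. R * h 0 x)" for S
    using der by (intro continuous_intros DERIV_continuous_on) (auto intro: has_field_derivative_at_within)
  \<comment> \<open>The derivative of \<open>h (Suc k)\<close> is at least \<open>c\<close> in
    absolute value, so \<open>\<bar>h (Suc k)\<bar>\<close> is below \<open>\<eta>\<close> only
    inside a short interval \<open>{s..t}\<close>. That interval gets the trivial bound; the outer
    pieces get the induction hypothesis with \<open>\<eta>\<close> in the role of
    \<open>c\<close>.\<close>
  obtain s t where st: "p \<le> s" "s \<le> t" "t \<le> q" "t - s \<le> 4 * \<eta> / c"
    and ps: "\<And>x. p < s \<Longrightarrow> x \<in> {p..s} \<Longrightarrow> \<eta> \<le> \<bar>h (Suc k) x\<bar>"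
    and tq: "\<And>x. t < q \<Longrightarrow> x \<in> {t..q} \<Longrightarrow> \<eta> \<le> \<bar>h (Suc k) x\<bar>"
    using sublevel_interval[of "h (Suc k)" "h (Suc (Suc k))" c p q \<eta>] der Suc.prems \<eta> by metis
  let ?I = "\<lambda>p q. integral {p..q} (\<lambda>x. e (R * h 0 x))"
  have 1: "norm (?I p s) \<le> B * \<eta>"
  proof (cases "p < s")
    case True
    have "norm (?I p s) \<le> B * inverse (\<eta>^2) * R powr (- \<delta>)"
      unfolding B_def \<delta>_def
      by (rule Suc.IH) (use \<eta> st Suc.prems ps[OF True] in auto)
    then show ?thesis
      using \<eta>2 by (simp add: mult.assoc)
  next
    case False
    then show ?thesis using st B \<eta> by simp
  qed
  have 2: "norm (?I t q) \<le> B * \<eta>"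
  proof (cases "t < q")
    case True
    have "norm (?I t q) \<le> B * inverse (\<eta>^2) * R powr (- \<delta>)"
      unfolding B_def \<delta>_def
      by (rule Suc.IH) (use \<eta> st Suc.prems tq[OF True] in auto)
    then show ?thesis
      using \<eta>2 by (simp add: mult.assoc)
  next
    case False
    then show ?thesis using st B \<eta> by simp
  qed
  have 3: "norm (?I s t) \<le> 4 * \<eta> / c"
    using norm_integral_e_le[OF cont st(2)] st(4) by linarith
  have int: "(\<lambda>x. e (R * h 0 x)) integrable_on {x..y}" for x y
    by (intro integrable_continuous_real continuous_on_e_comp cont)
  have "?I p q = ?I p s + ?I s t + ?I t q"
    using Henstock_Kurzweil_Integration.integral_combine[of p s q "\<lambda>x. e (R * h 0 x)"]
      Henstock_Kurzweil_Integration.integral_combine[of s t q "\<lambda>x. e (R * h 0 x)"] st int by (simp add: add.assoc)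
  then have "norm (?I p q) \<le> norm (?I p s) + norm (?I s t) + norm (?I t q)"
    by (simp add: norm_triangle_mono norm_triangle_ineq)
  \<comment> \<open>The trailing \<open>* 1\<close> is the slot that
    \<open>1 \<le> inverse (c^2)\<close> fills in the next step.\<close>
  also have "\<dots> \<le> 4 * \<eta> * inverse c + 2 * B * \<eta> * 1"
    using 1 2 3 by (simp add: divide_inverse)
  also have "\<dots> \<le> 4 * \<eta> * inverse (c^2) + 2 * B * \<eta> * inverse (c^2)"
  proof (intro add_mono mult_left_mono)
    show "inverse c \<le> inverse (c^2)"
      using Suc.prems by (simp add: power2_eq_square field_simps)
    show "1 \<le> inverse (c^2)"
      using Suc.prems by (simp add: one_le_inverse power_le_one)
  qed (use \<eta> B in auto)
  also have "\<dots> = (4 + 2 * B) * inverse (c^2) * \<eta>"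
    by (simp add: algebra_simps)
  also have "4 + 2 * B = (M * L + 6) * 2 ^ Suc k - 4"
    by (simp add: B_def)
  also have "\<eta> = R powr (- (1 / 3 ^ Suc k))"
    by (simp add: \<eta>_def \<delta>_def mult.commute)
  finally show ?case .
qed

section \<open>Uniform decay by compactness\<close>

lemma norm_integral_subdivision_le:
  fixes g :: "real \<Rightarrow> 'a::euclidean_space"
  assumes "g integrable_on {a..a + real m * d}" "d \<ge> 0"
    and "\<And>i. i < m \<Longrightarrow> norm (integral {a + real i * d..a + real (Suc i) * d} g) \<le> X"
  shows "norm (integral {a..a + real m * d} g) \<le> real m * X"
  using assms
proof (induction m)
  case (Suc m)
  have le: "a + real m * d \<le> a + real (Suc m) * d" "a \<le> a + real m * d"
    using Suc.prems(2) by (auto simp: algebra_simps)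
  have "integral {a..a + real (Suc m) * d} g
    = integral {a..a + real m * d} g + integral {a + real m * d..a + real (Suc m) * d} g"
    using Henstock_Kurzweil_Integration.integral_combine[OF le(2,1) Suc.prems(1)] by simp
  also have "norm \<dots> \<le> real m * X + X"
  proof (intro norm_triangle_mono)
    have "g integrable_on {a..a + real m * d}"
      using Suc.prems(1) integrable_on_subinterval le by fastforce
    then show "norm (integral {a..a + real m * d} g) \<le> real m * X"
      using Suc by simp
  qed (use Suc.prems(3)[of m] in auto)
  finally show ?case
    by (simp add: algebra_simps)
qed simp

text \<open>\<open>T\<close> consists of pairs of a parameter and a point. The bound is demanded on
  every subinterval whose slice lies in \<open>T\<close>, so one pair of constants serves every
  piece later found inside \<open>T\<close>, whatever its parameter.\<close>

definition decays_on ::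
    "('a \<Rightarrow> real \<Rightarrow> real) \<Rightarrow> real \<Rightarrow> real \<Rightarrow> real \<Rightarrow> real \<Rightarrow> ('a \<times> real) set \<Rightarrow> bool" where
  "decays_on g a b K \<delta> T \<longleftrightarrow>
     (\<forall>\<theta> p q R. a \<le> p \<longrightarrow> p \<le> q \<longrightarrow> q \<le> b \<longrightarrow> 1 \<le> R \<longrightarrow> {\<theta>} \<times> {p..q} \<subseteq> T \<longrightarrow>
        norm (integral {p..q} (\<lambda>x. e (R * g \<theta> x))) \<le> K * R powr (- \<delta>))"

text \<open>Only \<open>R \<ge> 1\<close> is considered, so a smaller exponent gives a weaker
  bound.\<close>

lemma decays_on_weaken:
  assumes "decays_on g a b K \<delta> T" "K \<le> K'" "\<delta>' \<le> \<delta>" "0 \<le> K'"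
  shows "decays_on g a b K' \<delta>' T"
  unfolding decays_on_def
proof (intro allI impI)
  fix \<theta> p q R
  assume *: "a \<le> p" "p \<le> q" "q \<le> b" "(1::real) \<le> R" "{\<theta>} \<times> {p..q} \<subseteq> T"
  then have "norm (integral {p..q} (\<lambda>x. e (R * g \<theta> x))) \<le> K * R powr (- \<delta>)"
    using assms(1) unfolding decays_on_def by blast
  also have "\<dots> \<le> K' * R powr (- \<delta>')"
    using assms * by (intro mult_mono powr_mono) auto
  finally show "norm (integral {p..q} (\<lambda>x. e (R * g \<theta> x))) \<le> K' * R powr (- \<delta>')" .
qed

text \<open>The largest constant and the smallest exponent work for the whole finite family.\<close>

lemma decays_on_uniform:
  assumes "finite D" "\<And>T. T \<in> D \<Longrightarrow> \<exists>K>0. \<exists>\<delta>>0. decays_on g a b K \<delta> T"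
  shows "\<exists>K>0. \<exists>\<delta>>0. \<forall>T\<in>D. decays_on g a b K \<delta> T"
  using assms
proof (induction D)
  case empty
  show ?case by (auto intro: exI[of _ 1])
next
  case (insert T D)
  obtain K \<delta> where 1: "K > 0" "\<delta> > 0" "\<And>T. T \<in> D \<Longrightarrow> decays_on g a b K \<delta> T"
    using insert by (metis insertCI)
  obtain K' \<delta>' where 2: "K' > 0" "\<delta>' > 0" "decays_on g a b K' \<delta>' T"
    using insert by (metis insertI1)
  have "decays_on g a b (max K K') (min \<delta> \<delta>') T'" if "T' \<in> insert T D" for T'
  proof (cases "T' = T")
    case True
    show ?thesis
      unfolding True by (rule decays_on_weaken[OF 2(3)]) (use 2 in auto)
  next
    case False
    with that have "T' \<in> D" by simp
    then show ?thesis
      by (rule decays_on_weaken[OF 1(3)]) (use 1 in auto)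
  qed
  moreover have "max K K' > 0" "min \<delta> \<delta>' > 0"
    using 1 2 by auto
  ultimately show ?case by blast
qed

text \<open>\<open>H \<theta> n\<close> is the \<open>n\<close>-th derivative of the phase
  \<open>H \<theta> 0\<close>. Each point of \<open>S \<times> {a..b}\<close> has an open
  neighbourhood on which the van der Corput estimate applies. A finite subcover makes the constants
  uniform, and its Lebesgue number says how finely to cut \<open>{a..b}\<close>.\<close>

lemma uniform_oscillatory_decay:
  fixes H :: "'a::metric_space \<Rightarrow> nat \<Rightarrow> real \<Rightarrow> real"
  assumes S: "compact S" and ab: "a \<le> b"
    and der: "\<And>\<theta> n x. (H \<theta> n has_real_derivative H \<theta> (Suc n) x) (at x)"
    and cont: "\<And>n. continuous_on UNIV (\<lambda>z. H (fst z) n (snd z))"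
    and nz: "\<And>\<theta> x. \<theta> \<in> S \<Longrightarrow> x \<in> {a..b} \<Longrightarrow> \<exists>n. H \<theta> (Suc n) x \<noteq> 0"
  shows "\<exists>K>0. \<exists>\<delta>>0. \<forall>\<theta>\<in>S. \<forall>R\<ge>1. norm (integral {a..b} (\<lambda>x. e (R * H \<theta> 0 x))) \<le> K * R powr (- \<delta>)"
proof -
  have cS: "compact (S \<times> {a..b})"
    using S by (intro compact_Times) auto
  have "compact ((\<lambda>z. H (fst z) 2 (snd z)) ` (S \<times> {a..b}))"
    by (intro compact_continuous_image cS continuous_on_subset[OF cont]) auto
  then obtain M where "\<forall>y\<in>(\<lambda>z. H (fst z) 2 (snd z)) ` (S \<times> {a..b}). norm y \<le> M"
    using compact_imp_bounded bounded_iff by metis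
  then have "\<bar>H (fst z) 2 (snd z)\<bar> \<le> M" if "z \<in> S \<times> {a..b}" for z
    using that by force
  then have M: "\<bar>H \<theta> 2 x\<bar> \<le> M" if "\<theta> \<in> S" "x \<in> {a..b}" for \<theta> x
    using that by (metis fst_conv snd_conv SigmaI)
  \<comment> \<open>The bound is made strict so that it defines an open condition.\<close>
  define M' where "M' = \<bar>M\<bar> + 1"
  have M': "\<bar>H \<theta> 2 x\<bar> < M'" if "\<theta> \<in> S" "x \<in> {a..b}" for \<theta> x
    using M[OF that] by (simp add: M'_def)
  define g where "g = (\<lambda>\<theta>. H \<theta> 0)"
  \<comment> \<open>The bound on \<open>H (fst z) 2\<close> is built into \<open>V\<close> because
    \<open>decays_on\<close> ranges over all parameters, not only those in \<open>S\<close>.\<close>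
  define V where "V = (\<lambda>n c. {z. c < \<bar>H (fst z) (Suc n) (snd z)\<bar>} \<inter> {z. \<bar>H (fst z) 2 (snd z)\<bar> < M'})"
  have openV: "open (V n c)" for n c
    unfolding V_def by (intro open_Int open_Collect_less continuous_intros cont)
  have decV: "\<exists>K>0. \<exists>\<delta>>0. decays_on g a b K \<delta> (V n c)" if "0 < c" "c \<le> 1" for n c
  proof -
    define K where "K = ((M' * (b - a) + 6) * 2 ^ n - 4) * inverse (c^2)"
    have "0 \<le> M'" by (simp add: M'_def)
    then have "6 * 1 \<le> (M' * (b - a) + 6) * 2 ^ n"
      using ab by (intro mult_mono) auto
    then have "K > 0"
      unfolding K_def using that by (intro mult_pos_pos) auto
    moreover have "decays_on g a b K (1 / 3 ^ n) (V n c)"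
      unfolding decays_on_def
    proof (intro allI impI)
      fix \<theta> p q R
      assume *: "a \<le> p" "p \<le> q" "q \<le> b" "(1::real) \<le> R" "{\<theta>} \<times> {p..q} \<subseteq> V n c"
      have "c < \<bar>H \<theta> (Suc n) x\<bar>" "\<bar>H \<theta> 2 x\<bar> < M'" if "x \<in> {p..q}" for x
        using subsetD[OF *(5), of "(\<theta>, x)"] that by (auto simp: V_def)
      then show "norm (integral {p..q} (\<lambda>x. e (R * g \<theta> x))) \<le> K * R powr (- (1 / 3 ^ n))"
        unfolding K_def g_def
        by (intro van_der_Corput[where h = "H \<theta>"] der) (use that * in \<open>auto intro: less_imp_le\<close>)
    qed
    ultimately show ?thesis
      by (metis zero_less_divide_1_iff zero_less_numeral zero_less_power)
  qed
  define \<C> where "\<C> = {V n c |n c. 0 < c \<and> c \<le> 1}"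
  have cover: "S \<times> {a..b} \<subseteq> \<Union>\<C>"
  proof
    fix z assume z: "z \<in> S \<times> {a..b}"
    then obtain n where n: "H (fst z) (Suc n) (snd z) \<noteq> 0"
      using nz by (cases z) auto
    \<comment> \<open>Halving gives a strict inequality, and the cap at 1 meets the requirement
      \<open>c \<le> 1\<close> of the van der Corput estimate.\<close>
    define c where "c = min 1 (\<bar>H (fst z) (Suc n) (snd z)\<bar> / 2)"
    have "0 < c" "c \<le> 1" "c < \<bar>H (fst z) (Suc n) (snd z)\<bar>"
      using n by (auto simp: c_def)
    moreover from this have "z \<in> V n c"
      using M'[of "fst z" "snd z"] z by (auto simp: V_def)
    ultimately show "z \<in> \<Union>\<C>"
      unfolding \<C>_def by blast
  qed
  obtain D where D: "D \<subseteq> \<C>" "finite D" "S \<times> {a..b} \<subseteq> \<Union>D"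
    using compactE[OF cS cover] openV unfolding \<C>_def by blast
  obtain K \<delta> where K: "K > 0" "\<delta> > 0" "\<And>T. T \<in> D \<Longrightarrow> decays_on g a b K \<delta> T"
    using decays_on_uniform[OF D(2), of g a b] D(1) decV unfolding \<C>_def by blast
  have "open T" if "T \<in> D" for T
    using D(1) that openV by (auto simp: \<C>_def)
  \<comment> \<open>\<open>\<epsilon>\<close> is a Lebesgue number of the finite subcover.\<close>
  then obtain \<epsilon> where \<epsilon>: "\<epsilon> > 0" "\<And>z. z \<in> S \<times> {a..b} \<Longrightarrow> \<exists>T\<in>D. ball z \<epsilon> \<subseteq> T"
    using Heine_Borel_lemma[OF cS D(3)] by metis
  \<comment> \<open>\<open>m\<close> is the number of pieces. Strictness makes each piece shorter
    than \<open>\<epsilon>\<close> and gives \<open>m > 0\<close> even if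
    \<open>a = b\<close>.\<close>
  obtain m :: nat where m: "(b - a) / \<epsilon> < real m"
    using reals_Archimedean2 by blast
  have "0 \<le> (b - a) / \<epsilon>"
    using ab \<epsilon>(1) by simp
  then have m0: "real m > 0"
    using m by linarith
  define d where "d = (b - a) / real m"
  have d: "0 \<le> d" "d < \<epsilon>" "a + real m * d = b"
    using ab m m0 \<epsilon>(1) by (auto simp: d_def field_simps)
  have "norm (integral {a..b} (\<lambda>x. e (R * g \<theta> x))) \<le> (real m * K) * R powr (- \<delta>)"
    if \<theta>: "\<theta> \<in> S" and R: "R \<ge> 1" for \<theta> R
  proof -
    have "continuous_on {a..b} (H \<theta> 0)"
      using der by (intro DERIV_continuous_on) (auto intro: has_field_derivative_at_within)
    then have "(\<lambda>x. e (R * g \<theta> x)) integrable_on {a..b}"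
      unfolding g_def by (intro integrable_continuous_real continuous_on_e_comp continuous_intros)
    moreover have "norm (integral {a + real i * d..a + real (Suc i) * d} (\<lambda>x. e (R * g \<theta> x)))
        \<le> K * R powr (- \<delta>)" if i: "i < m" for i
    proof -
      define p where "p = a + real i * d"
      have "real (Suc i) * d \<le> real m * d"
        using i d(1) by (intro mult_right_mono) auto
      then have pq: "a \<le> p" "p \<le> p + d" "p + d \<le> b"
        using d(1,3) by (auto simp: p_def algebra_simps)
      then obtain T where T: "T \<in> D" "ball (\<theta>, p) \<epsilon> \<subseteq> T"
        using \<epsilon>(2)[of "(\<theta>, p)"] \<theta> by auto
      \<comment> \<open>With the parameter fixed, the product distance is the distance on the line,
        at most \<open>d < \<epsilon>\<close>.\<close>
      have "{\<theta>} \<times> {p..p + d} \<subseteq> ball (\<theta>, p) \<epsilon>"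
        using d by (auto simp: dist_Pair_Pair dist_real_def)
      then have "norm (integral {p..p + d} (\<lambda>x. e (R * g \<theta> x))) \<le> K * R powr (- \<delta>)"
        using K(3)[OF T(1)] T(2) pq R unfolding decays_on_def by blast
      moreover have "p + d = a + real (Suc i) * d"
        by (simp add: p_def algebra_simps)
      ultimately show ?thesis
        unfolding p_def by simp
    qed
    ultimately show ?thesis
      using norm_integral_subdivision_le[of "\<lambda>x. e (R * g \<theta> x)" a m d "K * R powr (- \<delta>)"] d
      by (simp add: mult.assoc)
  qed
  moreover have "real m * K > 0"
    using m0 K by simp
  ultimately show ?thesis
    using K(2) unfolding g_def by blast
qed

section \<open>Reduction to unit vectors by scaling\<close>

theorem theorem1p14:
  fixes f :: "'k::finite \<Rightarrow> real \<Rightarrow> real" and a b :: real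
  assumes "\<And>j. real_analytic (f j)"
    and "lin_indep_with_one f"
    and "a \<le> b"
  shows "\<exists>C>0. \<exists>\<delta>>0. \<forall>l :: real ^ 'k. l \<noteq> 0 \<longrightarrow>
           norm (integral {a..b} (\<lambda>x. e (\<Sum>j\<in>UNIV. l $ j * f j x))) \<le> C * norm l powr (- \<delta>)"
proof -
  define H where "H = (\<lambda>(\<theta> :: real ^ 'k) n x. \<Sum>j\<in>UNIV. \<theta> $ j * (deriv ^^ n) (f j) x)"
  have derf: "((deriv ^^ n) (f j) has_real_derivative (deriv ^^ Suc n) (f j) x) (at x)" for n j x
    using real_analytic_DERIV[OF real_analytic_higher_deriv[OF assms(1)]] by simp
  have der: "(H \<theta> n has_real_derivative H \<theta> (Suc n) x) (at x)" for \<theta> n x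
    unfolding H_def by (intro DERIV_sum DERIV_cmult derf)
  have contf: "continuous_on S ((deriv ^^ n) (f j))" for S n j
    using derf by (intro DERIV_continuous_on) (auto intro: has_field_derivative_at_within)
  have cont: "continuous_on UNIV (\<lambda>z. H (fst z) n (snd z))" for n
    unfolding H_def
    by (intro continuous_intros continuous_on_compose2[OF contf[of UNIV]]) auto
  \<comment> \<open>This puts the derivatives into the iterated \<open>deriv\<close> form that the
    identity principle expects.\<close>
  have derH: "(deriv ^^ n) (H \<theta> 0) = H \<theta> n" for \<theta> n
    by (induction n) (auto intro!: DERIV_imp_deriv der)
  have an: "real_analytic (H \<theta> 0)" for \<theta>
    unfolding H_def using assms(1) by (intro real_analytic_sum real_analytic_cmult) simp
  \<comment> \<open>If all derivatives of positive order vanished at \<open>x\<close>, the phase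
    would be constant. That is a linear relation between 1 and the \<open>f j\<close> with constant
    coefficient \<open>- H \<theta> 0 0\<close>, and independence would force
    \<open>\<theta> = 0\<close>, against norm 1.\<close>
  have nz: "\<exists>n. H \<theta> (Suc n) x \<noteq> 0" if "\<theta> \<in> sphere 0 1" for \<theta> x
  proof (rule ccontr)
    assume "\<nexists>n. H \<theta> (Suc n) x \<noteq> 0"
    then have const: "H \<theta> 0 y = H \<theta> 0 0" for y
      using real_analytic_constant[OF an, of \<theta> x] derH by metis
    then have "\<forall>y. - H \<theta> 0 0 * 1 + (\<Sum>j\<in>UNIV. \<theta> $ j * f j y) = 0"
      by (simp add: H_def)
    then have "\<forall>j. \<theta> $ j = 0"
      using assms(2) unfolding lin_indep_with_one_def by blast
    then have "\<theta> = 0"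
      by (simp add: vec_eq_iff)
    with that show False by simp
  qed
  obtain K \<delta> where K: "K > 0" "\<delta> > 0"
    and bound: "\<And>\<theta> R. \<theta> \<in> sphere 0 1 \<Longrightarrow> R \<ge> 1 \<Longrightarrow>
      norm (integral {a..b} (\<lambda>x. e (R * H \<theta> 0 x))) \<le> K * R powr (- \<delta>)"
    using uniform_oscillatory_decay[OF compact_sphere assms(3) der cont nz] by metis
  \<comment> \<open>\<open>K\<close> serves vectors of norm at least 1. For shorter ones the trivial
    bound \<open>b - a\<close> suffices, because then \<open>norm l powr (- \<delta>)\<close> is at
    least 1.\<close>
  define C where "C = max K (b - a)"
  have "norm (integral {a..b} (\<lambda>x. e (\<Sum>j\<in>UNIV. l $ j * f j x))) \<le> C * norm l powr (- \<delta>)"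
    if l: "l \<noteq> 0" for l :: "real ^ 'k"
  proof -
    define R where "R = norm l"
    define \<theta> where "\<theta> = l /\<^sub>R R"
    have R: "R > 0" and \<theta>: "\<theta> \<in> sphere 0 1"
      using l by (auto simp: R_def \<theta>_def)
    have eq: "(\<Sum>j\<in>UNIV. l $ j * f j x) = R * H \<theta> 0 x" for x
      using R by (simp add: H_def \<theta>_def sum_distrib_left field_simps)
    show ?thesis
    proof (cases "R \<ge> 1")
      case True
      then have "norm (integral {a..b} (\<lambda>x. e (R * H \<theta> 0 x))) \<le> K * R powr (- \<delta>)"
        by (rule bound[OF \<theta>])
      also have "\<dots> \<le> C * R powr (- \<delta>)"
        by (intro mult_right_mono) (auto simp: C_def)
      finally show ?thesis
        by (simp add: eq flip: R_def)
    next
      case False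
      have "continuous_on {a..b} (\<lambda>x. R * H \<theta> 0 x)"
        unfolding H_def by (intro continuous_intros contf)
      then have "norm (integral {a..b} (\<lambda>x. e (R * H \<theta> 0 x))) \<le> b - a"
        by (rule norm_integral_e_le[OF _ assms(3)])
      also have "\<dots> \<le> C * 1"
        by (simp add: C_def)
      also have "\<dots> \<le> C * R powr (- \<delta>)"
      proof (rule mult_left_mono)
        show "1 \<le> R powr (- \<delta>)"
          using False R K powr_mono'[of "- \<delta>" 0 R] by simp
      qed (use K in \<open>auto simp: C_def\<close>)
      finally show ?thesis
        by (simp add: eq flip: R_def)
    qed
  qed
  moreover have "C > 0"
    using K by (simp add: C_def)
  ultimately show ?thesis
    using K(2) by blast
qed

end
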